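(* Let $k\ge 4$, let $\mathbb H=(V,\mathcal H)$ be a complete $3$-uniform $k$-partite hypergraph, and let $I_1,\dots,I_k$ be the corresponding partition of $V$ into independent sets. Then, for any admissible matching policy $\Phi$ and any $\mu\in\mathscr M(V)$, the model $(\mathbb H,\Phi,\mu)$ is stable if and only if $\mu(I_i)<1/3$ for any $i\in\{1,\dots,k\}$.
   Context: A hypergraph $\mathbb H=(V,\mathcal H)$ consists of a finite node set $V$ and a finite set $\mathcal H$ of subsets of $V$ (hyperedges) whose union is $V$. A $3$-uniform hypergraph (all hyperedges have cardinality $3$) is complete $k$-partite if there is a partition of $V$ into $k$ (nonempty) sets $I_1,\dots,I_k$ such that $\mathcal H$ consists exactly of all subsets $\{v_1,v_2,v_3\}$ with $v_1,v_2,v_3$ belonging to three distinct sets of the partition. $\mathscr M(V)$ is the set of probability measures $\mu$ on $V$ with $\mu(i)>0$ for all $i\in V$. Matching model $(\mathbb H,\Phi,\mu)$: at each time $n\ge1$ one item enters; its class $C_n\in V$ is drawn from $\mu$, and $(C_n)_n$ is i.i.d. If the buffer contains a set of items whose classes form, together with $C_n$, a hyperedge of $\mathcal H$ (one item per class), then the policy $\Phi$ selects one such set and all these items together with the incoming item leave the system immediately (a match is always performed whenever possible); otherwise the incoming item is stored in the buffer. The queue detail $W_n$ is the finite word over $V$ listing the classes of unmatched items just after the arrival at time $n$, in order of arrival; it takes values in the set of words $w$ such that for each $H\in\mathcal H$ some $i\in H$ does not occur in $w$. The policy $\Phi$ is admissible if the choice of the match of an incoming item depends solely on the queue detail upon arrival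 (and the incoming class), and possibly on an independent uniform draw in case of a tie. Then $(W_n)_{n\in\mathbb N}$ is a Markov chain, and the model is stable if this chain is positive recurrent. *)

theory Defs
  imports "HOL-Probability.Probability"
begin

section \<open>Hypergraphs\<close>

definition hypergraph :: "'a set \<Rightarrow> 'a set set \<Rightarrow> bool" where
  "hypergraph V E \<longleftrightarrow> finite V \<and> finite E \<and> \<Union>E = V"

definition uniform_hypergraph :: "nat \<Rightarrow> 'a set \<Rightarrow> 'a set set \<Rightarrow> bool" where
  "uniform_hypergraph r V E \<longleftrightarrow> hypergraph V E \<and> (\<forall>H\<in>E. card H = r)"

definition partition_into :: "'a set \<Rightarrow> nat \<Rightarrow> (nat \<Rightarrow> 'a set) \<Rightarrow> bool" where
  "partition_into V k I \<longleftrightarrow>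
     (\<Union>i\<in>{1..k}. I i) = V \<and> (\<forall>i\<in>{1..k}. I i \<noteq> {}) \<and> disjoint_family_on I {1..k}"

definition complete_3_uniform_partite ::
  "'a set \<Rightarrow> 'a set set \<Rightarrow> nat \<Rightarrow> (nat \<Rightarrow> 'a set) \<Rightarrow> bool" where
  "complete_3_uniform_partite V E k I \<longleftrightarrow>
     uniform_hypergraph 3 V E \<and> partition_into V k I \<and>
     E = {{v1, v2, v3} | v1 v2 v3.
            \<exists>i1\<in>{1..k}. \<exists>i2\<in>{1..k}. \<exists>i3\<in>{1..k}. i1 \<noteq> i2 \<and> i1 \<noteq> i3 \<and> i2 \<noteq> i3 \<and>
              v1 \<in> I i1 \<and> v2 \<in> I i2 \<and> v3 \<in> I i3}"

section \<open>Positive recurrence\<close>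

text \<open>
  \<open>X x \<omega> n\<close> is the state at time \<open>n\<close> of the chain started in state \<open>x\<close>.
  The infimum of the empty set is \<open>\<infinity>\<close>, so a finite mean return time entails almost sure return.
\<close>

definition return_time :: "(nat \<Rightarrow> 's) \<Rightarrow> 's \<Rightarrow> ennreal" where
  "return_time Y x = (INF n\<in>{n. 1 \<le> n \<and> Y n = x}. of_nat n)"

definition positive_recurrent ::
  "'w measure \<Rightarrow> 's set \<Rightarrow> ('s \<Rightarrow> 'w \<Rightarrow> nat \<Rightarrow> 's) \<Rightarrow> bool" where
  "positive_recurrent M S X \<longleftrightarrow> (\<forall>x\<in>S. (\<integral>\<^sup>+\<omega>. return_time (X x \<omega>) x \<partial>M) < \<infinity>)"

section \<open>The matching model\<close>

definition positive_prob_measures :: "'a set \<Rightarrow> 'a measure set" where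
  "positive_prob_measures V =
     {\<mu>. prob_space \<mu> \<and> sets \<mu> = Pow V \<and> (\<forall>i\<in>V. 0 < measure \<mu> {i})}"

definition queue_details :: "'a set \<Rightarrow> 'a set set \<Rightarrow> 'a list set" where
  "queue_details V E = {w \<in> lists V. \<forall>H\<in>E. \<exists>i\<in>H. i \<notin> set w}"

text \<open>
  The stored items are the positions of the queue detail \<open>w\<close>; the class of the item at
  position \<open>p\<close> is \<open>w ! p\<close>.  A possible match of an incoming item of class \<open>c\<close> is a set of positions.
\<close>

definition possible_matches :: "'a set set \<Rightarrow> 'a list \<Rightarrow> 'a \<Rightarrow> nat set set" where
  "possible_matches E w c =
     {P. P \<subseteq> {..<length w} \<and> inj_on ((!) w) P \<and> c \<notin> (!) w ` P \<and> insert c ((!) w ` P) \<in> E}"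

text \<open>
  \<open>\<Phi> w c u\<close> is the match chosen for an incoming item of class \<open>c\<close> when the queue detail upon
  arrival is \<open>w\<close> and the tie-breaking draw, uniform on \<open>[0,1]\<close>, is \<open>u\<close>.  Measurability in \<open>u\<close>
  is what makes the choice a random variable.
\<close>

type_synonym 'a policy = "'a list \<Rightarrow> 'a \<Rightarrow> real \<Rightarrow> nat set"

definition uniform_draw :: "real measure" where
  "uniform_draw = restrict_space lborel {0..1}"

definition admissible :: "'a set \<Rightarrow> 'a set set \<Rightarrow> 'a policy \<Rightarrow> bool" where
  "admissible V E \<Phi> \<longleftrightarrow>
     (\<forall>w\<in>queue_details V E. \<forall>c\<in>V. possible_matches E w c \<noteq> {} \<longrightarrow>
        (\<forall>u\<in>{0..1}. \<Phi> w c u \<in> possible_matches E w c) \<and>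
        \<Phi> w c \<in> measurable uniform_draw (count_space UNIV))"

definition arrival :: "'a set set \<Rightarrow> 'a policy \<Rightarrow> 'a list \<Rightarrow> 'a \<Rightarrow> real \<Rightarrow> 'a list" where
  "arrival E \<Phi> w c u =
     (if possible_matches E w c = {} then w @ [c] else nths w (- \<Phi> w c u))"

text \<open>
  The \<open>n\<close>-th entry (from \<open>0\<close>) of the stream \<open>\<omega>\<close> is the pair \<open>(C\<^sub>n\<^sub>+\<^sub>1, U\<^sub>n\<^sub>+\<^sub>1)\<close> of the class and the draw
  of the item entering at time \<open>n + 1\<close>.
\<close>

primrec queue :: "'a set set \<Rightarrow> 'a policy \<Rightarrow> 'a list \<Rightarrow> ('a \<times> real) stream \<Rightarrow> nat \<Rightarrow> 'a list" where
  "queue E \<Phi> w \<omega> 0 = w"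
| "queue E \<Phi> w \<omega> (Suc n) = arrival E \<Phi> (queue E \<Phi> w \<omega> n) (fst (\<omega> !! n)) (snd (\<omega> !! n))"

definition stable_model :: "'a set \<Rightarrow> 'a set set \<Rightarrow> 'a policy \<Rightarrow> 'a measure \<Rightarrow> bool" where
  "stable_model V E \<Phi> \<mu> \<longleftrightarrow>
     positive_recurrent (stream_space (\<mu> \<Otimes>\<^sub>M uniform_draw)) (queue_details V E) (queue E \<Phi>)"

end

theory Submission
  imports Defs
begin

text \<open>
  Number the parts by \<open>1,\<dots>,k\<close>, let \<open>w\<close> be a queue detail, \<open>n\<close> its length, \<open>x\<^sub>i\<close> its number of items
  of part \<open>i\<close>, and \<open>m\<^sub>i = \<mu>(I\<^sub>i)\<close>.  Not all the classes of a hyperedge occur in \<open>w\<close>, so \<open>w\<close> meets at most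
  two parts; hence an arrival of part \<open>l\<close> is matched exactly if \<open>w\<close> meets two parts other than \<open>l\<close>,
  and the match then takes one item from each of these two parts.  The policy decides which items leave, but it
  has no influence on the numbers \<open>x\<^sub>i\<close>.

  Sufficiency.  The quadratic form \<open>L = 3 \<Sum>\<^sub>i x\<^sub>i\<^sup>2 - n\<^sup>2\<close> is nonnegative by Cauchy--Schwarz, since at most two of the
  \<open>x\<^sub>i\<close> differ from \<open>0\<close>.  Its point is that an arrival of part \<open>l\<close> changes it by exactly \<open>6 x\<^sub>l - 2 n + 2\<close>,
  whether the item is stored or matched (\<open>energy_arrival\<close>).  The mean drift is therefore
  \<open>2 \<Sum>\<^sub>i (3 m\<^sub>i - 1) x\<^sub>i + 2\<close> (\<open>energy_drift\<close>); if all \<open>m\<^sub>i < 1/3\<close>, it is at most \<open>-1\<close> for long queues.  With the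
  fact that every state can be reached from every other one (\<open>leads_to_all\<close>), Foster's criterion
  (\<open>Foster_Lyapunov\<close>) gives finite mean return times.

  Necessity.  Each match uses at most one item of part \<open>i\<close> and three items altogether, so \<open>D = 3 x\<^sub>i - n\<close> grows by \<open>2\<close>
  with every arrival of part \<open>i\<close> and falls by at most \<open>1\<close> otherwise.  If \<open>m\<^sub>i \<ge> 1/3\<close>, then \<open>D\<close> is a submartingale with
  increments at most \<open>2\<close>.  From a state with \<open>D > 0\<close> such a process needs infinite mean time to reach a state
  with \<open>D \<le> 0\<close> (\<open>mean_hitting_eq_infinity\<close>); and after the arrival of a single item of part \<open>i\<close>, the empty
  queue is such a target.  So the mean return time of the empty queue is infinite, also in the critical case \<open>m\<^sub>i = 1/3\<close>.

  Both criteria are proved for an arbitrary iterated random map with countably many states.  They are statements about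
  \<open>h\<^sub>n(w)\<close>, the mean of the hitting time of a fixed state capped at \<open>n\<close>, which satisfies a first-step recursion
  in \<open>n\<close>; so ordinary induction on \<open>n\<close> replaces martingale limit theorems and the strong Markov property.
\<close>

section \<open>Hitting times and return times of a sequence\<close>

lemma min_add_1: "min (1 + a) (1 + b) = 1 + min a (b :: ennreal)"
  by (cases "a \<le> b") (simp_all add: min_absorb1 min_absorb2 add_left_mono)

lemma ennreal_integral_le_nn_integral:
  fixes g :: "'a \<Rightarrow> real"
  assumes "integrable N g"
  shows "ennreal (\<integral>x. g x \<partial>N) \<le> (\<integral>\<^sup>+x. ennreal (g x) \<partial>N)"
proof -
  have "ennreal (\<integral>x. g x \<partial>N) \<le> ennreal (\<integral>x. max 0 (g x) \<partial>N)"
    using assms by (intro ennreal_leI integral_mono) auto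
  also have "\<dots> = (\<integral>\<^sup>+x. ennreal (max 0 (g x)) \<partial>N)"
    using assms by (intro nn_integral_eq_integral[symmetric]) auto
  also have "\<dots> = (\<integral>\<^sup>+x. ennreal (g x) \<partial>N)"
    by (intro nn_integral_cong) (simp add: max_def ennreal_neg)
  finally show ?thesis .
qed

lemma INF_mono_eq_Least:
  fixes g :: "nat \<Rightarrow> ennreal"
  assumes "mono g" and "Q m"
  shows "(INF n\<in>{n. Q n}. g n) = g (LEAST n. Q n)"
proof (rule antisym)
  show "(INF n\<in>{n. Q n}. g n) \<le> g (LEAST n. Q n)"
    using LeastI[of Q m] assms(2) by (intro INF_lower) auto
  show "g (LEAST n. Q n) \<le> (INF n\<in>{n. Q n}. g n)"
    using assms(1) by (intro INF_greatest) (auto intro: monoD Least_le)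
qed

definition hitting_time :: "(nat \<Rightarrow> 's) \<Rightarrow> 's \<Rightarrow> ennreal" where
  "hitting_time Y x = (INF n\<in>{n. Y n = x}. of_nat n)"

lemma return_time_eq_hitting_time:
  "return_time Y x = 1 + hitting_time (\<lambda>n. Y (Suc n)) x"
proof -
  have "{n. 1 \<le> n \<and> Y n = x} = Suc ` {n. Y (Suc n) = x}"
    by (auto simp: image_iff) (metis Suc_le_D)
  then have eq: "return_time Y x = (INF n\<in>{n. Y (Suc n) = x}. 1 + of_nat n)"
    by (simp add: return_time_def image_comp comp_def add.commute)
  show ?thesis
  proof (cases "\<exists>n. Y (Suc n) = x")
    case True
    then obtain n where n: "Y (Suc n) = x" by blast
    have "mono (\<lambda>n. 1 + of_nat n :: ennreal)" "mono (\<lambda>n. of_nat n :: ennreal)"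
      by (auto simp: mono_def add_left_mono)
    then show ?thesis
      unfolding eq hitting_time_def using n
      by (simp add: INF_mono_eq_Least[where Q = "\<lambda>n. Y (Suc n) = x"])
  next
    case False
    then show ?thesis unfolding eq hitting_time_def by simp
  qed
qed

lemma hitting_time_here: "Y 0 = x \<Longrightarrow> hitting_time Y x = 0"
  unfolding hitting_time_def by (rule antisym[OF INF_lower2[of 0]]) auto

lemma hitting_time_later:
  assumes "Y 0 \<noteq> x"
  shows "hitting_time Y x = 1 + hitting_time (\<lambda>n. Y (Suc n)) x"
proof -
  have "{n. Y n = x} = {n. 1 \<le> n \<and> Y n = x}"
    using assms by (auto simp: Suc_le_eq intro: gr0I)
  then have "hitting_time Y x = return_time Y x"
    unfolding hitting_time_def return_time_def by simp
  then show ?thesis by (simp add: return_time_eq_hitting_time)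
qed

section \<open>Mean hitting times of an iterated random map\<close>

locale iterated_random_map = prob_space M for M :: "'e measure" +
  fixes S :: "'s set" and f :: "'s \<Rightarrow> 'e \<Rightarrow> 's"
  assumes countable_states: "countable S"
    and measurable_step: "w \<in> S \<Longrightarrow> f w \<in> measurable M (count_space S)"
begin

primrec orbit :: "'s \<Rightarrow> 'e stream \<Rightarrow> nat \<Rightarrow> 's" where
  "orbit w \<omega> 0 = w"
| "orbit w \<omega> (Suc n) = f (orbit w \<omega> n) (\<omega> !! n)"

lemma orbit_Suc_shift: "orbit w (e ## \<omega>) (Suc n) = orbit (f w e) \<omega> n"
  by (induction n) auto

lemma step_in_states: "w \<in> S \<Longrightarrow> e \<in> space M \<Longrightarrow> f w e \<in> S"
  using measurable_space[OF measurable_step] by simp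

lemma borel_measurable_comp_step: "w \<in> S \<Longrightarrow> (\<lambda>e. g (f w e) :: 'b :: topological_space) \<in> borel_measurable M"
  by (rule measurable_compose[OF measurable_step]) auto

lemma measurable_orbit:
  assumes "w \<in> S"
  shows "(\<lambda>\<omega>. orbit w \<omega> n) \<in> measurable (stream_space M) (count_space S)"
proof (induction n)
  case 0
  then show ?case using assms by simp
next
  case (Suc n)
  have "(\<lambda>\<omega>. f (orbit w \<omega> n) (\<omega> !! n)) \<in> measurable (stream_space M) (count_space S)"
    by (rule measurable_compose_countable'[OF _ Suc countable_states])
       (rule measurable_compose[OF measurable_snth measurable_step])
  then show ?case by simp
qed

lemma measurable_hitting_time_orbit:
  assumes "w \<in> S"
  shows "(\<lambda>\<omega>. hitting_time (orbit w \<omega>) x) \<in> borel_measurable (stream_space M)"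
proof -
  have eq: "hitting_time Y x = (INF n. if Y n = x then of_nat n else \<infinity>)" for Y :: "nat \<Rightarrow> 's"
  proof (unfold hitting_time_def, rule antisym)
    show "(INF n\<in>{n. Y n = x}. of_nat n) \<le> (INF n. if Y n = x then of_nat n else \<infinity> :: ennreal)"
      by (intro INF_greatest) (simp add: INF_lower)
    show "(INF n. if Y n = x then of_nat n else \<infinity> :: ennreal) \<le> (INF n\<in>{n. Y n = x}. of_nat n)"
    proof (rule INF_greatest)
      fix n assume "n \<in> {n. Y n = x}"
      then show "(INF n. if Y n = x then of_nat n else \<infinity> :: ennreal) \<le> of_nat n"
        by (intro INF_lower2[of n]) auto
    qed
  qed
  have "(\<lambda>\<omega>. if orbit w \<omega> n = x then of_nat n else \<infinity> :: ennreal) \<in> borel_measurable (stream_space M)" for n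
    by (rule measurable_compose[OF measurable_orbit[OF assms]]) simp
  then show ?thesis unfolding eq by measurable
qed

text \<open>
  The mean of the hitting time of \<open>x\<close> from \<open>w\<close>, capped at the given horizon; the equations are its first-step
  analysis, and \<open>capped_mean_eq\<close> identifies it with the integral over the stream of inputs.
\<close>

primrec capped_mean :: "'s \<Rightarrow> nat \<Rightarrow> 's \<Rightarrow> ennreal" where
  "capped_mean x 0 w = 0"
| "capped_mean x (Suc n) w = (if w = x then 0 else 1 + (\<integral>\<^sup>+e. capped_mean x n (f w e) \<partial>M))"

lemma capped_mean_le_Suc: "capped_mean x n w \<le> capped_mean x (Suc n) w"
  by (induction n arbitrary: w) (auto intro!: add_left_mono nn_integral_mono)

lemma capped_mean_le: "w \<in> S \<Longrightarrow> capped_mean x n w \<le> of_nat n"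
proof (induction n arbitrary: w)
  case (Suc n)
  have "(\<integral>\<^sup>+e. capped_mean x n (f w e) \<partial>M) \<le> (\<integral>\<^sup>+e. of_nat n \<partial>M)"
    by (intro nn_integral_mono Suc.IH step_in_states Suc.prems)
  also have "\<dots> = of_nat n" by (simp add: emeasure_space_1)
  finally show ?case by (auto intro: add_left_mono)
qed simp

lemma capped_mean_eq:
  assumes "w \<in> S"
  shows "(\<integral>\<^sup>+\<omega>. min (hitting_time (orbit w \<omega>) x) (of_nat n) \<partial>stream_space M) = capped_mean x n w"
  using assms
proof (induction n arbitrary: w)
  case (Suc n)
  interpret str: prob_space "stream_space M" by (rule prob_space_stream_space)
  have meas: "(\<lambda>\<omega>. min (hitting_time (orbit v \<omega>) x) (of_nat m)) \<in> borel_measurable (stream_space M)"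
    if "v \<in> S" for v m
    using measurable_hitting_time_orbit[OF that] by measurable
  show ?case
  proof (cases "w = x")
    case True
    then show ?thesis by (simp add: hitting_time_here)
  next
    case False
    have "min (hitting_time (orbit w (e ## \<omega>)) x) (of_nat (Suc n)) =
      1 + min (hitting_time (orbit (f w e) \<omega>) x) (of_nat n)" for e \<omega>
      using False by (simp add: hitting_time_later orbit_Suc_shift min_add_1 del: orbit.simps(2))
    then have "(\<integral>\<^sup>+\<omega>. min (hitting_time (orbit w \<omega>) x) (of_nat (Suc n)) \<partial>stream_space M) =
      (\<integral>\<^sup>+e. (\<integral>\<^sup>+\<omega>. 1 + min (hitting_time (orbit (f w e) \<omega>) x) (of_nat n) \<partial>stream_space M) \<partial>M)"
      by (subst nn_integral_stream_space[OF meas[OF Suc.prems]]) simp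
    also have "\<dots> = (\<integral>\<^sup>+e. 1 + capped_mean x n (f w e) \<partial>M)"
      using step_in_states[OF Suc.prems]
      by (intro nn_integral_cong) (simp add: nn_integral_add meas Suc.IH str.emeasure_space_1)
    also have "\<dots> = 1 + (\<integral>\<^sup>+e. capped_mean x n (f w e) \<partial>M)"
      by (subst nn_integral_add) (auto simp: emeasure_space_1 borel_measurable_comp_step Suc.prems)
    finally show ?thesis using False by simp
  qed
qed simp

definition mean_hitting :: "'s \<Rightarrow> 's \<Rightarrow> ennreal" where
  "mean_hitting x w = (SUP n. capped_mean x n w)"

lemma mean_hitting_eq:
  assumes "w \<in> S"
  shows "(\<integral>\<^sup>+\<omega>. hitting_time (orbit w \<omega>) x \<partial>stream_space M) = mean_hitting x w"
proof -
  have "(SUP n. min a (of_nat n)) = a" for a :: ennreal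
    using inf_SUP[of a "\<lambda>n. of_nat n" UNIV] by (simp add: inf_min ennreal_SUP_of_nat_eq_top)
  then have "(\<integral>\<^sup>+\<omega>. hitting_time (orbit w \<omega>) x \<partial>stream_space M) =
     (\<integral>\<^sup>+\<omega>. (SUP n. min (hitting_time (orbit w \<omega>) x) (of_nat n)) \<partial>stream_space M)" by simp
  also have "\<dots> = (SUP n. \<integral>\<^sup>+\<omega>. min (hitting_time (orbit w \<omega>) x) (of_nat n) \<partial>stream_space M)"
    using measurable_hitting_time_orbit[OF assms]
    by (intro nn_integral_monotone_convergence_SUP)
       (auto simp: incseq_def le_fun_def intro: min.coboundedI2)
  also have "\<dots> = mean_hitting x w"
    unfolding mean_hitting_def capped_mean_eq[OF assms] ..
  finally show ?thesis .
qed

text \<open>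
  After the first step, returning to \<open>x\<close> is hitting \<open>x\<close>; so bounds on mean return times reduce to bounds on
  \<open>capped_mean\<close> that are uniform in the horizon.
\<close>

lemma mean_return_time:
  assumes "x \<in> S"
  shows "(\<integral>\<^sup>+\<omega>. return_time (orbit x \<omega>) x \<partial>stream_space M) = 1 + (\<integral>\<^sup>+e. mean_hitting x (f x e) \<partial>M)"
proof -
  interpret str: prob_space "stream_space M" by (rule prob_space_stream_space)
  have "(\<lambda>\<omega>. hitting_time (\<lambda>n. orbit x \<omega> (Suc n)) x) \<in> borel_measurable (stream_space M)"
  proof -
    have "(\<lambda>\<omega>. hitting_time (orbit (f x (shd \<omega>)) (stl \<omega>)) x) \<in> borel_measurable (stream_space M)"
      by (rule measurable_compose_countable'[OF measurable_compose[OF measurable_stl measurable_hitting_time_orbit]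
            measurable_compose[OF measurable_shd measurable_step[OF assms]] countable_states])
    moreover have "(\<lambda>n. orbit x \<omega> (Suc n)) = orbit (f x (shd \<omega>)) (stl \<omega>)" for \<omega>
      using orbit_Suc_shift[of x "shd \<omega>" "stl \<omega>"] by (simp add: fun_eq_iff)
    ultimately show ?thesis by simp
  qed
  then have "(\<lambda>\<omega>. return_time (orbit x \<omega>) x) \<in> borel_measurable (stream_space M)"
    unfolding return_time_eq_hitting_time by measurable
  then have "(\<integral>\<^sup>+\<omega>. return_time (orbit x \<omega>) x \<partial>stream_space M) =
     (\<integral>\<^sup>+e. (\<integral>\<^sup>+\<omega>. 1 + hitting_time (orbit (f x e) \<omega>) x \<partial>stream_space M) \<partial>M)"
    by (subst nn_integral_stream_space)
       (simp_all add: return_time_eq_hitting_time orbit_Suc_shift del: orbit.simps(2))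
  also have "\<dots> = (\<integral>\<^sup>+e. 1 + mean_hitting x (f x e) \<partial>M)"
    using step_in_states[OF assms]
    by (intro nn_integral_cong)
       (simp add: nn_integral_add measurable_hitting_time_orbit mean_hitting_eq str.emeasure_space_1)
  also have "\<dots> = 1 + (\<integral>\<^sup>+e. mean_hitting x (f x e) \<partial>M)"
    by (subst nn_integral_add) (auto simp: emeasure_space_1 borel_measurable_comp_step assms)
  finally show ?thesis .
qed

section \<open>Foster's criterion\<close>

text \<open>
  Reachability in the form that Foster's criterion consumes: in each step an event of positive probability is
  prescribed, and all of its finitely many outcomes must lead on to \<open>x\<close>.  The finiteness is what permits a
  common lower bound for the probabilities of the remaining steps.
\<close>

inductive leads_to :: "'s \<Rightarrow> 's \<Rightarrow> bool" for x where
  here: "leads_to x x"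
| step: "w \<in> S \<Longrightarrow> A \<in> sets M \<Longrightarrow> 0 < prob A \<Longrightarrow> finite (f w ` A) \<Longrightarrow>
    (\<And>e. e \<in> A \<Longrightarrow> leads_to x (f w e)) \<Longrightarrow> leads_to x w"

text \<open>
  While the process stays outside \<open>F\<close>, the decrease of \<open>L\<close> pays for the time; once it enters \<open>F\<close>, at most \<open>G\<close> is left.
\<close>

lemma capped_mean_le_Lyapunov_add:
  assumes drift: "\<And>w. w \<in> S - F \<Longrightarrow> 1 + (\<integral>\<^sup>+e. L (f w e) \<partial>M) \<le> L w"
    and bound: "\<And>v. v \<in> F \<Longrightarrow> capped_mean x n v \<le> G"
    and "w \<in> S"
  shows "capped_mean x n w \<le> L w + G"
  using bound \<open>w \<in> S\<close>
proof (induction n arbitrary: w)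
  case (Suc n)
  have bound_n: "capped_mean x n v \<le> G" if "v \<in> F" for v
    using capped_mean_le_Suc[of x n v] Suc.prems(1)[OF that] by (rule order_trans)
  show ?case
  proof (cases "w \<in> F \<or> w = x")
    case True
    then show ?thesis using Suc.prems(1)[of w] by (auto intro: add_increasing)
  next
    case False
    have "capped_mean x (Suc n) w \<le> 1 + (\<integral>\<^sup>+e. L (f w e) + G \<partial>M)"
      using False Suc.IH[OF bound_n step_in_states[OF Suc.prems(2)]]
      by (auto intro!: add_left_mono nn_integral_mono)
    also have "\<dots> = 1 + (\<integral>\<^sup>+e. L (f w e) \<partial>M) + G"
      by (subst nn_integral_add)
         (auto simp: emeasure_space_1 add.assoc intro!: borel_measurable_comp_step Suc.prems(2))
    also have "\<dots> \<le> L w + G"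
      using False Suc.prems(2) by (intro add_right_mono drift) auto
    finally show ?thesis .
  qed
qed simp

text \<open>
  If \<open>G\<close> bounds the capped means on \<open>F\<close>, then a state from which \<open>x\<close> is reached with probability at least \<open>p\<close>
  along a path of bounded length has capped mean at most \<open>C + (1 - p) G\<close>: with probability \<open>p\<close> the path is followed, and when
  it is left, the previous lemma bounds the remaining time by \<open>L\<close> plus \<open>G\<close>.  It matters that \<open>C\<close> and \<open>p\<close> do not
  depend on the horizon.
\<close>

lemma leads_to_imp_contraction:
  assumes drift: "\<And>w. w \<in> S - F \<Longrightarrow> 1 + (\<integral>\<^sup>+e. L (f w e) \<partial>M) \<le> L w"
    and finite_drift: "\<And>w. w \<in> S \<Longrightarrow> (\<integral>\<^sup>+e. L (f w e) \<partial>M) < \<infinity>"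
    and "leads_to x w"
  shows "\<exists>C p. 0 \<le> C \<and> 0 < p \<and> p \<le> 1 \<and> (\<forall>n G. 0 \<le> G \<longrightarrow> (\<forall>v\<in>F. capped_mean x n v \<le> ennreal G) \<longrightarrow>
           capped_mean x n w \<le> ennreal (C + (1 - p) * G))"
  using \<open>leads_to x w\<close>
proof (induction rule: leads_to.induct)
  case here
  have "capped_mean x n x = 0" for n by (cases n) auto
  then show ?case by (intro exI[of _ 0] exI[of _ 1]) auto
next
  case (step w A)
  let ?P = "\<lambda>v C p. 0 \<le> C \<and> 0 < p \<and> p \<le> 1 \<and> (\<forall>n G. 0 \<le> G \<longrightarrow> (\<forall>v\<in>F. capped_mean x n v \<le> ennreal G) \<longrightarrow>
           capped_mean x n v \<le> ennreal (C + (1 - p) * G))"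
  have "\<forall>v\<in>f w ` A. \<exists>C p. ?P v C p" using step.IH by blast
  then obtain Cf pf where Pf: "\<And>v. v \<in> f w ` A \<Longrightarrow> ?P v (Cf v) (pf v)" by metis
  have ne: "f w ` A \<noteq> {}" using step.hyps(3) by auto
  define C where "C = Max (Cf ` f w ` A)"
  define p where "p = Min (pf ` f w ` A)"
  have C: "Cf v \<le> C" and p: "p \<le> pf v" if "v \<in> f w ` A" for v
    unfolding C_def p_def using that step.hyps(4) by (auto intro!: Max_ge Min_le)
  have "p \<in> pf ` f w ` A" unfolding p_def using ne step.hyps(4) by (intro Min_in) auto
  then have p0: "0 < p" "p \<le> 1" using Pf by auto
  have "C \<in> Cf ` f w ` A" unfolding C_def using ne step.hyps(4) by (intro Max_in) auto
  then have C0: "0 \<le> C" using Pf by auto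
  define K where "K = enn2real (\<integral>\<^sup>+e. L (f w e) \<partial>M)"
  have K: "(\<integral>\<^sup>+e. L (f w e) \<partial>M) = ennreal K" "0 \<le> K"
    unfolding K_def using finite_drift[OF step.hyps(1)] by (auto simp: ennreal_enn2real)
  define q where "q = prob A"
  have q: "0 < q" "q \<le> 1" unfolding q_def using step.hyps(3) by auto
  have "capped_mean x n w \<le> ennreal (1 + C + K + (1 - q * p) * G)"
    if G: "0 \<le> G" and bound: "\<forall>v\<in>F. capped_mean x n v \<le> ennreal G" for n G
  proof (cases n)
    case 0
    have "q * p \<le> 1" using q p0 by (simp add: mult_le_one)
    then show ?thesis using 0 by simp
  next
    case (Suc m)
    have bound_m: "capped_mean x m v \<le> ennreal G" if "v \<in> F" for v
      using capped_mean_le_Suc[of x m v] bound that unfolding Suc by (meson order_trans)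
    have pt: "capped_mean x m (f w e) \<le>
      L (f w e) + ennreal (C + (1 - p) * G) * indicator A e + ennreal G * indicator (space M - A) e"
      if e: "e \<in> space M" for e
    proof (cases "e \<in> A")
      case True
      have "capped_mean x m (f w e) \<le> ennreal (Cf (f w e) + (1 - pf (f w e)) * G)"
        using Pf[of "f w e"] True G bound_m by blast
      also have "\<dots> \<le> ennreal (C + (1 - p) * G)"
        using True C[of "f w e"] p[of "f w e"] G
        by (intro ennreal_leI add_mono mult_right_mono) auto
      finally show ?thesis using True by (simp add: add_increasing)
    next
      case False
      then show ?thesis
        using capped_mean_le_Lyapunov_add[of F L x m "ennreal G", OF drift bound_m step_in_states[OF step.hyps(1) e]] e
        by simp
    qed
    have "capped_mean x n w \<le> 1 + (\<integral>\<^sup>+e. capped_mean x m (f w e) \<partial>M)"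
      unfolding Suc by simp
    also have "\<dots> \<le> 1 + (\<integral>\<^sup>+e. L (f w e) + ennreal (C + (1 - p) * G) * indicator A e
        + ennreal G * indicator (space M - A) e \<partial>M)"
      by (intro add_left_mono nn_integral_mono pt)
    also have "\<dots> = 1 + (ennreal K + ennreal (C + (1 - p) * G) * emeasure M A + ennreal G * emeasure M (space M - A))"
      using step.hyps(2) borel_measurable_comp_step[OF step.hyps(1), of "\<lambda>v. L v"]
      by (simp add: nn_integral_add nn_integral_cmult_indicator K)
    also have "\<dots> = ennreal (1 + (K + (C + (1 - p) * G) * q + G * (1 - q)))"
    proof -
      have em: "emeasure M A = ennreal q" "emeasure M (space M - A) = ennreal (1 - q)"
        using step.hyps(2) by (simp_all add: emeasure_eq_measure prob_compl q_def)
      have arith: "1 + (ennreal K + ennreal a * ennreal q + ennreal G * ennreal r) =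
          ennreal (1 + (K + a * q + G * r))" if "0 \<le> a" "0 \<le> r" for a r
        using that q(1) K(2) G by (simp add: ennreal_mult)
      show ?thesis unfolding em by (rule arith) (use C0 p0 G q(2) in auto)
    qed
    also have "\<dots> \<le> ennreal (1 + C + K + (1 - q * p) * G)"
      using mult_left_le[of q C] q C0 by (intro ennreal_leI) (simp add: algebra_simps)
    finally show ?thesis .
  qed
  then show ?case
    using C0 K p0 q by (intro exI[of _ "1 + C + K"] exI[of _ "q * p"]) (auto simp: mult_le_one)
qed

text \<open>
  Taking for \<open>G\<close> the largest capped mean on \<open>F\<close> in the contraction estimate gives \<open>G \<le> C + (1 - p) G\<close>, hence
  \<open>G \<le> C / p\<close>, a bound that is uniform in the horizon.
\<close>

theorem Foster_Lyapunov:
  assumes drift: "\<And>w. w \<in> S - F \<Longrightarrow> 1 + (\<integral>\<^sup>+e. L (f w e) \<partial>M) \<le> L w"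
    and finite_drift: "\<And>w. w \<in> S \<Longrightarrow> (\<integral>\<^sup>+e. L (f w e) \<partial>M) < \<infinity>"
    and F: "finite F" "F \<subseteq> S"
    and reach: "\<And>w. w \<in> F \<Longrightarrow> leads_to x w"
    and "x \<in> S"
  shows "(\<integral>\<^sup>+\<omega>. return_time (orbit x \<omega>) x \<partial>stream_space M) < \<infinity>"
proof -
  let ?P = "\<lambda>v C p. 0 \<le> C \<and> 0 < p \<and> p \<le> 1 \<and> (\<forall>n G. 0 \<le> G \<longrightarrow> (\<forall>v\<in>F. capped_mean x n v \<le> ennreal G) \<longrightarrow>
           capped_mean x n v \<le> ennreal (C + (1 - p) * G))"
  have "\<forall>v\<in>F. \<exists>C p. ?P v C p"
    using leads_to_imp_contraction[OF drift finite_drift reach] by blast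
  then obtain Cf pf where Pf: "\<And>v. v \<in> F \<Longrightarrow> ?P v (Cf v) (pf v)" by metis
  define B where "B = (\<Sum>v\<in>F. Cf v / pf v)"
  have bound: "capped_mean x n v \<le> ennreal B" if "v \<in> F" for n v
  proof -
    \<comment> \<open>Capped means are finite, so the inequality for their maximum on \<open>F\<close> can be solved in the reals.\<close>
    define g where "g v = enn2real (capped_mean x n v)" for v
    have fin: "capped_mean x n v = ennreal (g v)" if "v \<in> F" for v
      unfolding g_def using capped_mean_le[of v x n] F(2) that
      by (subst ennreal_enn2real) (auto simp: top_unique less_top[symmetric])
    define G where "G = Max (g ` F)"
    have "G \<in> g ` F" unfolding G_def using that F(1) by (intro Max_in) auto
    then obtain u where u: "u \<in> F" "G = g u" by auto
    have G0: "0 \<le> G" unfolding u g_def by simp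
    have le_G: "g v \<le> G" if "v \<in> F" for v unfolding G_def using that F(1) by auto
    then have "capped_mean x n u \<le> ennreal (Cf u + (1 - pf u) * G)"
      using Pf[OF u(1)] G0 by (auto simp: fin intro!: ennreal_leI)
    moreover have "0 \<le> (1 - pf u) * G" using Pf[OF u(1)] G0 by simp
    ultimately have "G \<le> Cf u + (1 - pf u) * G"
      using Pf[OF u(1)] by (simp add: fin[OF u(1)] flip: u(2) ennreal_plus)
    then have "G \<le> Cf u / pf u" using Pf[OF u(1)] by (simp add: field_simps)
    also have "\<dots> \<le> B" unfolding B_def using F(1) u(1) Pf by (intro member_le_sum) (auto intro!: divide_nonneg_pos)
    finally show ?thesis using le_G[OF that] by (simp add: fin[OF that] ennreal_leI)
  qed
  have "mean_hitting x v \<le> L v + ennreal B" if "v \<in> S" for v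
    unfolding mean_hitting_def
    by (intro SUP_least capped_mean_le_Lyapunov_add[OF drift bound that])
  then have "(\<integral>\<^sup>+e. mean_hitting x (f x e) \<partial>M) \<le> (\<integral>\<^sup>+e. L (f x e) + ennreal B \<partial>M)"
    using step_in_states[OF \<open>x \<in> S\<close>] by (intro nn_integral_mono) auto
  also have "\<dots> = (\<integral>\<^sup>+e. L (f x e) \<partial>M) + ennreal B"
    by (subst nn_integral_add) (auto simp: emeasure_space_1 intro!: borel_measurable_comp_step \<open>x \<in> S\<close>)
  also have "\<dots> < \<infinity>" using finite_drift[OF \<open>x \<in> S\<close>] by (simp add: less_top)
  finally show ?thesis unfolding mean_return_time[OF \<open>x \<in> S\<close>] by (simp add: less_top)
qed

section \<open>A submartingale criterion for infinite mean hitting times\<close>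

text \<open>
  The \<open>j\<close>-th summand bounds from below the probability that \<open>x\<close> has not been hit up to time \<open>j\<close>.  If \<open>D' \<le> D + B\<close> is
  the value after one step, then \<open>D' / (D' + j B) \<ge> D' / (D + (j + 1) B)\<close> if \<open>D' > 0\<close>, while for \<open>D' \<le> 0\<close> the
  right-hand side is at most \<open>0\<close>.  So the bound for the next \<open>j\<close> follows by averaging, because the right-hand side is linear
  in \<open>D'\<close>.
\<close>

lemma capped_mean_ge_submartingale:
  fixes D :: "'s \<Rightarrow> real"
  assumes target: "D x \<le> 0" and "0 < B"
    and incr: "\<And>w e. w \<in> S \<Longrightarrow> e \<in> space M \<Longrightarrow> D (f w e) \<le> D w + B"
    and int: "\<And>w. w \<in> S \<Longrightarrow> integrable M (\<lambda>e. D (f w e))"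
    and sub: "\<And>w. w \<in> S \<Longrightarrow> D w \<le> (\<integral>e. D (f w e) \<partial>M)"
    and "w \<in> S" "0 < D w"
  shows "ennreal (\<Sum>j<n. D w / (D w + real j * B)) \<le> capped_mean x n w"
  using \<open>w \<in> S\<close> \<open>0 < D w\<close>
proof (induction n arbitrary: w)
  case (Suc n)
  define \<kappa> where "\<kappa> = (\<Sum>j<n. 1 / (D w + B + real j * B))"
  have \<kappa>: "0 \<le> \<kappa>" unfolding \<kappa>_def using Suc.prems \<open>0 < B\<close> by (intro sum_nonneg) auto
  have pt: "ennreal (D (f w e) * \<kappa>) \<le> capped_mean x n (f w e)" if e: "e \<in> space M" for e
  proof (cases "0 < D (f w e)")
    case True
    have "D (f w e) * \<kappa> \<le> (\<Sum>j<n. D (f w e) / (D (f w e) + real j * B))"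
      unfolding \<kappa>_def sum_distrib_left
      using True incr[OF Suc.prems(1) e] \<open>0 < B\<close> Suc.prems(2)
      by (intro sum_mono) (auto intro!: divide_left_mono mult_pos_pos add_pos_nonneg)
    then show ?thesis
      using Suc.IH[OF step_in_states[OF Suc.prems(1) e] True] by (meson ennreal_leI order_trans)
  next
    case False
    then have "D (f w e) * \<kappa> \<le> 0" using \<kappa> by (simp add: mult_nonpos_nonneg)
    then show ?thesis by (simp add: ennreal_neg)
  qed
  have split: "(\<Sum>j<Suc n. D w / (D w + real j * B)) = 1 + D w * \<kappa>"
    unfolding \<kappa>_def sum.lessThan_Suc_shift sum_distrib_left using Suc.prems
    by (simp add: algebra_simps)
  have "ennreal (D w * \<kappa>) \<le> ennreal (\<integral>e. D (f w e) * \<kappa> \<partial>M)"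
    using sub[OF Suc.prems(1)] \<kappa> by (intro ennreal_leI) (simp add: mult_right_mono)
  also have "\<dots> \<le> (\<integral>\<^sup>+e. ennreal (D (f w e) * \<kappa>) \<partial>M)"
    using integrable_mult_left[OF int[OF Suc.prems(1)], of \<kappa>] by (rule ennreal_integral_le_nn_integral)
  also have "\<dots> \<le> (\<integral>\<^sup>+e. capped_mean x n (f w e) \<partial>M)"
    by (intro nn_integral_mono pt)
  finally show ?case
    unfolding split using Suc.prems target \<kappa> by (auto intro: add_left_mono)
qed simp

text \<open>
  The lower bounds of the previous lemma are partial sums of a series that diverges like the harmonic series.
\<close>

theorem mean_hitting_eq_infinity:
  fixes D :: "'s \<Rightarrow> real"
  assumes target: "D x \<le> 0" and "0 < B"
    and incr: "\<And>w e. w \<in> S \<Longrightarrow> e \<in> space M \<Longrightarrow> D (f w e) \<le> D w + B"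
    and int: "\<And>w. w \<in> S \<Longrightarrow> integrable M (\<lambda>e. D (f w e))"
    and sub: "\<And>w. w \<in> S \<Longrightarrow> D w \<le> (\<integral>e. D (f w e) \<partial>M)"
    and "w \<in> S" "0 < D w"
  shows "mean_hitting x w = \<infinity>"
proof -
  let ?t = "\<lambda>j. D w / (D w + real j * B)"
  have "\<not> summable ?t"
  proof
    assume "summable ?t"
    then have "summable (\<lambda>j. (D w + B) / D w * ?t j)" by (rule summable_mult)
    moreover have "norm (inverse (real (Suc j))) \<le> (D w + B) / D w * ?t j" for j
    proof -
      have "D w + real j * B \<le> (D w + B) * real (Suc j)"
        using assms(2,7) by (simp add: algebra_simps)
      moreover have "0 < D w + real j * B" using assms(2,7) by (simp add: add_pos_nonneg)
      ultimately show ?thesis using assms(7)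
        by (simp add: divide_simps del: of_nat_Suc)
    qed
    ultimately have "summable (\<lambda>j. inverse (real (Suc j)))"
      by (rule summable_comparison_test'[where N = 0])
    then show False
      using not_summable_harmonic[where 'a = real] summable_Suc_iff[of "\<lambda>n. inverse (real n)"] by simp
  qed
  moreover have "0 \<le> ?t j" for j using assms(2,7) by simp
  ultimately have "(\<Sum>j. ennreal (?t j)) = top"
    by (intro summable_iff_suminf_neq_top)
  then have "\<infinity> = (\<Sum>j. ennreal (?t j))" unfolding infinity_ennreal_def by (rule sym)
  also have "\<dots> = (SUP n. \<Sum>j<n. ennreal (?t j))" by (rule suminf_eq_SUP)
  also have "\<dots> \<le> mean_hitting x w"
    unfolding mean_hitting_def
    using capped_mean_ge_submartingale[OF assms] \<open>\<And>j. 0 \<le> ?t j\<close>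
    by (intro SUP_mono) (auto simp: sum_ennreal)
  finally show ?thesis by (simp add: top_unique)
qed

end

section \<open>Removing two items from a list\<close>

lemma count_list_nths:
  "real (count_list (nths xs A) y) = (\<Sum>p<length xs. if p \<in> A \<and> xs ! p = y then 1 else 0)"
  by (induction xs rule: rev_induct) (auto simp: nths_append nth_append intro!: sum.cong)

lemma count_list_eq_sum:
  "real (count_list xs y) = (\<Sum>p<length xs. if xs ! p = y then 1 else 0)"
  using count_list_nths[of xs UNIV y] by (simp add: nths_all)

lemma count_list_nths_remove2:
  assumes "p < length xs" "q < length xs" "p \<noteq> q"
  shows "real (count_list (nths xs (- {p, q})) y) = real (count_list xs y) - of_bool (y = xs ! p) - of_bool (y = xs ! q)"
proof -
  have "(\<Sum>r<length xs. if r \<in> - {p, q} \<and> xs ! r = y then 1 else 0) =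
    (\<Sum>r<length xs. (if xs ! r = y then 1 else 0) - (if r = p then of_bool (y = xs ! p) else 0)
       - (if r = q then of_bool (y = xs ! q) else 0 :: real))"
    using assms(3) by (intro sum.cong) auto
  also have "\<dots> = real (count_list xs y) - of_bool (y = xs ! p) - of_bool (y = xs ! q)"
    using assms(1,2) by (simp add: sum_subtractf sum.delta count_list_eq_sum)
  finally show ?thesis by (simp add: count_list_nths)
qed

lemma length_nths_remove2:
  assumes "p < length xs" "q < length xs" "p \<noteq> q"
  shows "length (nths xs (- {p, q})) + 2 = length xs"
proof -
  have "{i. i < length xs \<and> i \<in> - {p, q}} = {..<length xs} - {p, q}" by auto
  moreover have "card {p, q} \<le> card {..<length xs}" using assms by (intro card_mono) auto
  ultimately show ?thesis using assms by (simp add: length_nths card_Diff_subset)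
qed

section \<open>The parts of a queue detail\<close>

locale partite_matching =
  fixes V :: "'a set" and E :: "'a set set" and k :: nat and I :: "nat \<Rightarrow> 'a set" and \<Phi> :: "'a policy"
  assumes three_parts: "3 \<le> k"
    and partite: "complete_3_uniform_partite V E k I"
    and adm: "admissible V E \<Phi>"
begin

abbreviation "S \<equiv> queue_details V E"

definition part :: "'a \<Rightarrow> nat" where
  "part v = (THE i. i \<in> {1..k} \<and> v \<in> I i)"

lemma partition: "partition_into V k I"
  using partite unfolding complete_3_uniform_partite_def by (elim conjE)

lemma parts_cover: "(\<Union>i\<in>{1..k}. I i) = V"
  using partition unfolding partition_into_def by (elim conjE)

lemma parts_disjoint: "i \<in> {1..k} \<Longrightarrow> j \<in> {1..k} \<Longrightarrow> v \<in> I i \<Longrightarrow> v \<in> I j \<Longrightarrow> i = j"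
  using partition unfolding partition_into_def disjoint_family_on_def by (elim conjE) blast

lemma finite_V: "finite V"
  using partite unfolding complete_3_uniform_partite_def uniform_hypergraph_def hypergraph_def
  by (elim conjE)

lemma part_eq: "i \<in> {1..k} \<Longrightarrow> v \<in> I i \<Longrightarrow> part v = i"
  unfolding part_def by (intro the_equality conjI) (blast intro: parts_disjoint)+

lemma part_in:
  assumes "v \<in> V"
  shows "part v \<in> {1..k}" "v \<in> I (part v)"
proof -
  obtain i where "i \<in> {1..k}" "v \<in> I i"
    using assms parts_cover by blast
  then show "part v \<in> {1..k}" "v \<in> I (part v)" using part_eq by auto
qed

lemma I_eq: "i \<in> {1..k} \<Longrightarrow> I i = {v \<in> V. part v = i}"
proof (intro equalityI subsetI CollectI conjI)
  assume i: "i \<in> {1..k}"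
  show "v \<in> V" "part v = i" if "v \<in> I i" for v
    using part_eq[OF i that] parts_cover i that by auto
  show "v \<in> I i" if "v \<in> {v \<in> V. part v = i}" for v
    using part_in(2)[of v] that by simp
qed

lemma I_nonempty: "i \<in> {1..k} \<Longrightarrow> \<exists>v\<in>V. part v = i"
proof -
  assume i: "i \<in> {1..k}"
  then have "I i \<noteq> {}" using partition unfolding partition_into_def by (elim conjE) (rule bspec)
  then show ?thesis using I_eq[OF i] by blast
qed

lemma hyperedge_iff: "H \<in> E \<longleftrightarrow> H \<subseteq> V \<and> card H = 3 \<and> inj_on part H"
proof
  assume "H \<in> E"
  then obtain v1 v2 v3 i1 i2 i3 where H: "H = {v1, v2, v3}"
    and i: "i1 \<in> {1..k}" "i2 \<in> {1..k}" "i3 \<in> {1..k}" "i1 \<noteq> i2" "i1 \<noteq> i3" "i2 \<noteq> i3"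
    and v: "v1 \<in> I i1" "v2 \<in> I i2" "v3 \<in> I i3"
    using partite unfolding complete_3_uniform_partite_def by blast
  have p: "part v1 = i1" "part v2 = i2" "part v3 = i3" using part_eq i v by auto
  moreover have "v1 \<in> V" "v2 \<in> V" "v3 \<in> V" using v i I_eq by auto
  moreover have "v1 \<noteq> v2" "v1 \<noteq> v3" "v2 \<noteq> v3" using p i by auto
  ultimately show "H \<subseteq> V \<and> card H = 3 \<and> inj_on part H" using H i by auto
next
  assume H: "H \<subseteq> V \<and> card H = 3 \<and> inj_on part H"
  then obtain v1 v2 v3 where v: "H = {v1, v2, v3}" "v1 \<noteq> v2" "v1 \<noteq> v3" "v2 \<noteq> v3"
    by (auto simp: card_3_iff)
  then have "part v1 \<noteq> part v2" "part v1 \<noteq> part v3" "part v2 \<noteq> part v3"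
    using H by (auto simp: inj_on_def)
  then have "\<exists>v1 v2 v3. H = {v1, v2, v3} \<and> (\<exists>i1\<in>{1..k}. \<exists>i2\<in>{1..k}. \<exists>i3\<in>{1..k}.
      i1 \<noteq> i2 \<and> i1 \<noteq> i3 \<and> i2 \<noteq> i3 \<and> v1 \<in> I i1 \<and> v2 \<in> I i2 \<and> v3 \<in> I i3)"
    using part_in[of v1] part_in[of v2] part_in[of v3] v H by blast
  then show "H \<in> E" using partite unfolding complete_3_uniform_partite_def by blast
qed

text \<open>
  Representatives of three different parts of \<open>w\<close> would form a hyperedge, so a queue detail meets at most two parts.
\<close>

lemma queue_details_iff: "w \<in> S \<longleftrightarrow> set w \<subseteq> V \<and> card (part ` set w) \<le> 2"
proof
  assume w: "w \<in> S"
  then have V: "set w \<subseteq> V" by (auto simp: queue_details_def)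
  moreover have "card (part ` set w) \<le> 2"
  proof (rule ccontr)
    assume "\<not> ?thesis"
    then obtain T where T: "T \<subseteq> part ` set w" "card T = 3"
      by (metis obtain_subset_with_card_n not_less_eq_eq numeral_2_eq_2 numeral_3_eq_3)
    then obtain H where H: "H \<subseteq> set w" "inj_on part H" "T = part ` H"
      by (auto simp: subset_image_inj)
    then have "H \<in> E" using T V by (auto simp: hyperedge_iff card_image)
    then show False using w H(1) by (auto simp: queue_details_def)
  qed
  ultimately show "set w \<subseteq> V \<and> card (part ` set w) \<le> 2" by blast
next
  assume w: "set w \<subseteq> V \<and> card (part ` set w) \<le> 2"
  have "\<not> H \<subseteq> set w" if "H \<in> E" for H
  proof
    assume "H \<subseteq> set w"
    then have "card (part ` H) \<le> card (part ` set w)" by (intro card_mono) auto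
    then show False using that w by (simp add: hyperedge_iff card_image)
  qed
  then show "w \<in> S" using w by (auto simp: queue_details_def)
qed

lemma possible_match_iff:
  assumes "set w \<subseteq> V" "c \<in> V"
  shows "P \<in> possible_matches E w c \<longleftrightarrow> (\<exists>p q. P = {p, q} \<and> p < length w \<and> q < length w \<and>
     part (w ! p) \<noteq> part (w ! q) \<and> part (w ! p) \<noteq> part c \<and> part (w ! q) \<noteq> part c)"
proof
  assume "P \<in> possible_matches E w c"
  then have P: "P \<subseteq> {..<length w}" "inj_on ((!) w) P" "c \<notin> (!) w ` P" "insert c ((!) w ` P) \<in> E"
    by (auto simp: possible_matches_def)
  have "finite P" using P(1) finite_subset by blast
  then have "card P = 2"
    using P by (simp add: hyperedge_iff card_image)
  then obtain p q where pq: "P = {p, q}" "p \<noteq> q" by (auto simp: card_2_iff)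
  then have "w ! p \<noteq> w ! q" using P(2) by auto
  then show "\<exists>p q. P = {p, q} \<and> p < length w \<and> q < length w \<and>
     part (w ! p) \<noteq> part (w ! q) \<and> part (w ! p) \<noteq> part c \<and> part (w ! q) \<noteq> part c"
    using P pq by (intro exI[of _ p] exI[of _ q]) (auto simp: hyperedge_iff)
next
  assume "\<exists>p q. P = {p, q} \<and> p < length w \<and> q < length w \<and>
     part (w ! p) \<noteq> part (w ! q) \<and> part (w ! p) \<noteq> part c \<and> part (w ! q) \<noteq> part c"
  then obtain p q where pq: "P = {p, q}" "p < length w" "q < length w"
     "part (w ! p) \<noteq> part (w ! q)" "part (w ! p) \<noteq> part c" "part (w ! q) \<noteq> part c" by blast
  then have "w ! p \<noteq> w ! q" "w ! p \<noteq> c" "w ! q \<noteq> c" by auto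
  then show "P \<in> possible_matches E w c"
    using pq assms by (auto simp: possible_matches_def hyperedge_iff)
qed

lemma possible_matches_empty_iff:
  assumes "set w \<subseteq> V" "c \<in> V"
  shows "possible_matches E w c = {} \<longleftrightarrow> card (part ` set w - {part c}) \<le> 1"
proof -
  have "possible_matches E w c \<noteq> {} \<longleftrightarrow>
    \<not> (\<forall>a\<in>part ` set w - {part c}. \<forall>b\<in>part ` set w - {part c}. a = b)"
  proof -
    have "part ` set w = (\<lambda>p. part (w ! p)) ` {..<length w}"
      by (auto simp: set_conv_nth image_iff)
    moreover have "possible_matches E w c \<noteq> {} \<longleftrightarrow> (\<exists>p<length w. \<exists>q<length w.
      part (w ! p) \<noteq> part (w ! q) \<and> part (w ! p) \<noteq> part c \<and> part (w ! q) \<noteq> part c)"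
      unfolding ex_in_conv[symmetric] possible_match_iff[OF assms] by blast
    ultimately show ?thesis by auto
  qed
  moreover have "card (part ` set w - {part c}) \<le> 1 \<longleftrightarrow>
      (\<forall>a\<in>part ` set w - {part c}. \<forall>b\<in>part ` set w - {part c}. a = b)"
    unfolding One_nat_def by (rule card_le_Suc0_iff_eq) simp
  ultimately show ?thesis by metis
qed

text \<open>
  A matched item finds two parts other than its own in the queue, which are then the only parts of the queue.
  This determines the effect of an arrival on the numbers of items of the parts, whatever the policy.
\<close>

lemma arrival_cases:
  assumes w: "w \<in> S" and c: "c \<in> V" and u: "u \<in> {0..1}"
  obtains (stored) "possible_matches E w c = {}" "arrival E \<Phi> w c u = w @ [c]"
  | (matched) p q where "p < length w" "q < length w" "p \<noteq> q" "part (w ! p) \<noteq> part (w ! q)"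
      "part ` set w = {part (w ! p), part (w ! q)}" "part c \<notin> part ` set w"
      "arrival E \<Phi> w c u = nths w (- {p, q})"
proof (cases "possible_matches E w c = {}")
  case True
  then show ?thesis using stored by (simp add: arrival_def)
next
  case False
  have wV: "set w \<subseteq> V" and card: "card (part ` set w) \<le> 2" using w by (auto simp: queue_details_iff)
  have "\<Phi> w c u \<in> possible_matches E w c" using adm w c u False unfolding admissible_def by blast
  then obtain p q where pq: "\<Phi> w c u = {p, q}" "p < length w" "q < length w"
     "part (w ! p) \<noteq> part (w ! q)" "part (w ! p) \<noteq> part c" "part (w ! q) \<noteq> part c"
    using possible_match_iff[OF wV c] by blast
  have parts: "{part (w ! p), part (w ! q)} = part ` set w"
    using pq card by (intro card_seteq) auto
  have "part c \<notin> part ` set w" using pq(5,6) unfolding parts[symmetric] by simp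
  moreover have "p \<noteq> q" using pq(4) by auto
  moreover have "arrival E \<Phi> w c u = nths w (- {p, q})" using False pq(1) by (simp add: arrival_def)
  ultimately show ?thesis using matched[of p q] pq(2-4) parts False by simp
qed

lemma arrival_in_queue_details:
  assumes w: "w \<in> S" and c: "c \<in> V" and u: "u \<in> {0..1}"
  shows "arrival E \<Phi> w c u \<in> S"
  using w c u
proof (cases rule: arrival_cases)
  case stored
  have wV: "set w \<subseteq> V" and card: "card (part ` set w) \<le> 2" using w by (auto simp: queue_details_iff)
  have "card (insert (part c) (part ` set w)) \<le> 2"
    using stored(1) possible_matches_empty_iff[OF wV c] by (simp add: card.insert_remove)
  then show ?thesis using stored wV c by (auto simp: queue_details_iff)
next
  case (matched p q)
  have "card (part ` set (nths w (- {p, q}))) \<le> card (part ` set w)"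
    by (intro card_mono image_mono) (auto dest: in_set_nthsD)
  then show ?thesis using w matched(7) by (auto simp: queue_details_iff dest: in_set_nthsD)
qed

section \<open>The effect of an arrival\<close>

definition load :: "'a list \<Rightarrow> nat \<Rightarrow> real" where
  "load w i = real (count_list (map part w) i)"

lemma load_nonneg: "0 \<le> load w i" by (simp add: load_def)

lemma load_eq_0: "i \<notin> part ` set w \<Longrightarrow> load w i = 0"
  by (simp add: load_def)

lemma load_snoc: "load (w @ [c]) i = load w i + of_bool (i = part c)"
  by (simp add: load_def)

lemma sum_load:
  assumes "set w \<subseteq> V"
  shows "(\<Sum>i=1..k. load w i) = real (length w)"
proof -
  have "set (map part w) \<subseteq> {1..k}" using assms part_in(1) unfolding set_map by blast
  then have "sum (count_list (map part w)) {1..k} = length w"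
    using sum_count_set[of "map part w" "{1..k}"] by simp
  then show ?thesis unfolding load_def of_nat_sum[symmetric] by simp
qed

lemma load_remove2:
  assumes "p < length w" "q < length w" "p \<noteq> q"
  shows "load (nths w (- {p, q})) i = load w i - of_bool (i = part (w ! p)) - of_bool (i = part (w ! q))"
  using count_list_nths_remove2[of p "map part w" q i] assms
  by (simp add: load_def nths_map)

definition excess :: "nat \<Rightarrow> 'a list \<Rightarrow> real" where
  "excess i w = 3 * load w i - real (length w)"

text \<open>
  The excess changes by \<open>2\<close> or by \<open>-1\<close>.  The decrease occurs when an item of another part is stored or is matched with
  an item of part \<open>i\<close>.  When a match involves no item of part \<open>i\<close> besides possibly the incoming one,
  the excess grows by \<open>2\<close>, because the queue gets shorter by \<open>2\<close>.
\<close>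

lemma excess_arrival:
  assumes w: "w \<in> S" and c: "c \<in> V" and u: "u \<in> {0..1}"
  shows "excess i w + (3 * of_bool (part c = i) - 1) \<le> excess i (arrival E \<Phi> w c u)"
    and "excess i (arrival E \<Phi> w c u) \<le> excess i w + 2"
proof -
  have "excess i w + (3 * of_bool (part c = i) - 1) \<le> excess i (arrival E \<Phi> w c u) \<and>
    excess i (arrival E \<Phi> w c u) \<le> excess i w + 2"
    using w c u
  proof (cases rule: arrival_cases)
    case stored
    then show ?thesis by (auto simp: excess_def load_snoc)
  next
    case (matched p q)
    then have "real (length w) = real (length (nths w (- {p, q}))) + 2"
      using length_nths_remove2[of p w q] by simp
    then show ?thesis using matched by (auto simp: excess_def load_remove2)
  qed
  then show "excess i w + (3 * of_bool (part c = i) - 1) \<le> excess i (arrival E \<Phi> w c u)"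
    and "excess i (arrival E \<Phi> w c u) \<le> excess i w + 2" by auto
qed

text \<open>
  If \<open>a\<close> and \<open>b\<close> are the numbers of items of the two parts that occur, this is \<open>2 (a\<^sup>2 - a b + b\<^sup>2)\<close>.
  The negative mixed term is what makes the mean drift negative for \<open>b = 0\<close> and large \<open>a\<close>, where no match
  is possible and the number of items can only grow.
\<close>

definition energy :: "'a list \<Rightarrow> real" where
  "energy w = 3 * (\<Sum>i=1..k. (load w i)\<^sup>2) - (real (length w))\<^sup>2"

lemma energy_nonneg:
  assumes "w \<in> S"
  shows "0 \<le> energy w"
proof -
  have wV: "set w \<subseteq> V" and card: "card (part ` set w) \<le> 2" using assms by (auto simp: queue_details_iff)
  let ?J = "part ` set w"
  have J: "?J \<subseteq> {1..k}" using wV part_in(1) by blast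
  have "real (length w) = (\<Sum>i\<in>?J. load w i)"
    unfolding sum_load[OF wV, symmetric] using J by (intro sum.mono_neutral_right) (auto intro: load_eq_0)
  then have "(real (length w))\<^sup>2 \<le> (\<Sum>i\<in>?J. (load w i)\<^sup>2) * real (card ?J)"
    by (simp add: sum_squared_le_sum_of_squares)
  also have "\<dots> \<le> (\<Sum>i\<in>?J. (load w i)\<^sup>2) * 3"
    using card by (intro mult_left_mono sum_nonneg) auto
  also have "(\<Sum>i\<in>?J. (load w i)\<^sup>2) = (\<Sum>i=1..k. (load w i)\<^sup>2)"
    using J by (intro sum.mono_neutral_left) (auto simp: load_eq_0)
  finally show ?thesis by (simp add: energy_def)
qed

text \<open>
  Storing an item adds \<open>3 (2 x\<^sub>l + 1) - (2 n + 1)\<close>.  Matching it with one item each of the parts \<open>i\<close> and \<open>j\<close> adds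
  \<open>3 (2 - 2 x\<^sub>i - 2 x\<^sub>j) + 4 n - 4\<close>, and this is the same number because then \<open>x\<^sub>i + x\<^sub>j = n\<close> and \<open>x\<^sub>l = 0\<close>.
\<close>

lemma energy_arrival:
  assumes w: "w \<in> S" and c: "c \<in> V" and u: "u \<in> {0..1}"
  shows "energy (arrival E \<Phi> w c u) = energy w + 6 * load w (part c) - 2 * real (length w) + 2"
  using w c u
proof (cases rule: arrival_cases)
  case stored
  have "(\<Sum>i=1..k. (load (w @ [c]) i)\<^sup>2) =
    (\<Sum>i=1..k. (load w i)\<^sup>2 + (if i = part c then 2 * load w (part c) + 1 else 0))"
    by (intro sum.cong) (auto simp: load_snoc power2_eq_square algebra_simps)
  also have "\<dots> = (\<Sum>i=1..k. (load w i)\<^sup>2) + 2 * load w (part c) + 1"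
    using part_in(1)[OF c] by (simp add: sum.distrib)
  finally show ?thesis using stored by (simp add: energy_def power2_eq_square algebra_simps)
next
  case (matched p q)
  have wV: "set w \<subseteq> V" using w by (auto simp: queue_details_iff)
  let ?i = "part (w ! p)" and ?j = "part (w ! q)"
  have ij: "?i \<in> {1..k}" "?j \<in> {1..k}" using matched(1,2) wV part_in(1) nth_mem by blast+
  have len: "real (length w) = load w ?i + load w ?j"
  proof -
    have "real (length w) = (\<Sum>i\<in>{?i, ?j}. load w i)"
      unfolding sum_load[OF wV, symmetric] using ij matched(5)
      by (intro sum.mono_neutral_right) (auto simp: load_eq_0)
    then show ?thesis using matched(4) by simp
  qed
  have len': "real (length (nths w (- {p, q}))) = real (length w) - 2"
    using length_nths_remove2[OF matched(1-3)] by simp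
  have "(\<Sum>i=1..k. (load (nths w (- {p, q})) i)\<^sup>2) =
    (\<Sum>i=1..k. (load w i)\<^sup>2 + (if i = ?i then 1 - 2 * load w ?i else 0) + (if i = ?j then 1 - 2 * load w ?j else 0))"
    using matched(4) by (intro sum.cong) (auto simp: load_remove2[OF matched(1-3)] power2_eq_square algebra_simps)
  also have "\<dots> = (\<Sum>i=1..k. (load w i)\<^sup>2) + (1 - 2 * load w ?i) + (1 - 2 * load w ?j)"
    using ij by (simp add: sum.distrib)
  also have "\<dots> = (\<Sum>i=1..k. (load w i)\<^sup>2) + 2 - 2 * real (length w)" using len by simp
  finally have sum: "(\<Sum>i=1..k. (load (nths w (- {p, q})) i)\<^sup>2) = (\<Sum>i=1..k. (load w i)\<^sup>2) + 2 - 2 * real (length w)" .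
  show ?thesis
    unfolding matched(7) energy_def sum len' load_eq_0[OF matched(6)] by (simp add: power2_eq_square algebra_simps)
qed

end

section \<open>The queue as an iterated random map\<close>

locale partite_matching_model = partite_matching +
  fixes \<mu> :: "'a measure"
  assumes law: "\<mu> \<in> positive_prob_measures V"
begin

lemma sets_law: "sets \<mu> = Pow V"
  using law by (simp add: positive_prob_measures_def)

lemma space_law: "space \<mu> = V"
  using sets_law by (metis Pow_iff sets.sets_into_space sets.top subset_antisym subset_refl)

lemma space_uniform_draw: "space uniform_draw = {0..1}"
  by (simp add: uniform_draw_def space_restrict_space)

sublocale law: prob_space \<mu>
  using law by (simp add: positive_prob_measures_def)

sublocale draw: prob_space uniform_draw
  by (rule prob_spaceI) (simp add: uniform_draw_def space_restrict_space emeasure_restrict_space)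

sublocale items: pair_prob_space \<mu> uniform_draw ..

abbreviation next_queue :: "'a list \<Rightarrow> 'a \<times> real \<Rightarrow> 'a list" where
  "next_queue w e \<equiv> arrival E \<Phi> w (fst e) (snd e)"

lemma countable_queue_details: "countable S"
proof (rule countable_subset)
  show "S \<subseteq> lists V" by (auto simp: queue_details_def)
  show "countable (lists V)" using finite_V by (intro countable_lists countable_finite)
qed

sublocale chain: iterated_random_map "\<mu> \<Otimes>\<^sub>M uniform_draw" S next_queue
proof unfold_locales
  show "countable S" by (rule countable_queue_details)
  fix w assume w: "w \<in> S"
  have "(\<lambda>u. arrival E \<Phi> w c u) \<in> measurable uniform_draw (count_space S)" if c: "c \<in> V" for c
  proof (cases "possible_matches E w c = {}")
    case True
    then have "arrival E \<Phi> w c u = w @ [c]" for u by (simp add: arrival_def)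
    moreover have "w @ [c] \<in> S"
      using arrival_in_queue_details[OF w c, of 0] calculation by simp
    ultimately show ?thesis by simp
  next
    case False
    then have "\<Phi> w c \<in> measurable uniform_draw (count_space UNIV)"
      using adm w c unfolding admissible_def by blast
    then have meas: "(\<lambda>u. nths w (- \<Phi> w c u)) \<in> measurable uniform_draw (count_space UNIV)"
      by (rule measurable_compose) simp
    have eq: "arrival E \<Phi> w c = (\<lambda>u. nths w (- \<Phi> w c u))"
      using False by (simp add: arrival_def fun_eq_iff)
    show ?thesis
      using arrival_in_queue_details[OF w c] measurable_sets[OF meas, of "{_}"]
      by (simp add: measurable_count_space_eq_countable[OF countable_queue_details] space_uniform_draw eq)
  qed
  then have "next_queue w \<in> measurable (count_space V \<Otimes>\<^sub>M uniform_draw) (count_space S)"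
    using finite_V by (intro measurable_pair_measure_countable1) (auto intro: countable_finite)
  then show "next_queue w \<in> measurable (\<mu> \<Otimes>\<^sub>M uniform_draw) (count_space S)"
    by (subst measurable_cong_sets[OF sets_pair_measure_cong[OF _ refl] refl]) (simp_all add: sets_law)
qed

lemma queue_eq_orbit: "queue E \<Phi> w \<omega> = chain.orbit w \<omega>"
proof
  fix n show "queue E \<Phi> w \<omega> n = chain.orbit w \<omega> n" by (induction n) auto
qed

lemma stable_model_iff:
  "stable_model V E \<Phi> \<mu> \<longleftrightarrow>
     (\<forall>x\<in>S. (\<integral>\<^sup>+\<omega>. return_time (chain.orbit x \<omega>) x \<partial>stream_space (\<mu> \<Otimes>\<^sub>M uniform_draw)) < \<infinity>)"
  by (simp add: stable_model_def positive_recurrent_def queue_eq_orbit)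

lemma class_event:
  assumes "A \<subseteq> V"
  shows "A \<times> {0..1} \<in> sets (\<mu> \<Otimes>\<^sub>M uniform_draw)"
    and "measure (\<mu> \<Otimes>\<^sub>M uniform_draw) (A \<times> {0..1}) = measure \<mu> A"
proof -
  have A: "A \<in> sets \<mu>" "{0..1} \<in> sets uniform_draw"
    using assms sets_law sets.top[of uniform_draw] by (auto simp: space_uniform_draw)
  then show "A \<times> {0..1} \<in> sets (\<mu> \<Otimes>\<^sub>M uniform_draw)" by (rule pair_measureI)
  show "measure (\<mu> \<Otimes>\<^sub>M uniform_draw) (A \<times> {0..1}) = measure \<mu> A"
    using A draw.emeasure_space_1
    by (simp add: measure_def draw.emeasure_pair_measure_Times space_uniform_draw)
qed

lemma integral_part:
  fixes g :: "nat \<Rightarrow> real"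
  shows "integrable (\<mu> \<Otimes>\<^sub>M uniform_draw) (\<lambda>e. g (part (fst e)))"
    and "(\<integral>e. g (part (fst e)) \<partial>(\<mu> \<Otimes>\<^sub>M uniform_draw)) = (\<Sum>i=1..k. g i * measure \<mu> (I i))"
proof -
  have eq: "g (part (fst e)) = (\<Sum>i=1..k. g i * indicator (I i \<times> {0..1}) e)"
    if "e \<in> space (\<mu> \<Otimes>\<^sub>M uniform_draw)" for e
  proof -
    have e: "fst e \<in> V" "snd e \<in> {0..1}"
      using that by (auto simp: space_pair_measure space_law space_uniform_draw)
    have "(\<Sum>i=1..k. g i * indicator (I i \<times> {0..1}) e) = (\<Sum>i=1..k. if i = part (fst e) then g i else 0)"
      using e by (intro sum.cong) (auto simp: I_eq indicator_def mem_Times_iff)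
    then show ?thesis using part_in(1)[OF e(1)] by simp
  qed
  have sub: "I i \<subseteq> V" if "i \<in> {1..k}" for i using I_eq[OF that] by auto
  have int: "integrable (\<mu> \<Otimes>\<^sub>M uniform_draw) (\<lambda>e. g i * indicator (I i \<times> {0..1}) e)" if "i \<in> {1..k}" for i
    using class_event(1)[OF sub[OF that]] by (intro integrable_mult_right integrable_real_indicator)
      (auto simp: items.emeasure_eq_measure)
  show "integrable (\<mu> \<Otimes>\<^sub>M uniform_draw) (\<lambda>e. g (part (fst e)))"
    by (subst Bochner_Integration.integrable_cong[OF refl eq], assumption) (rule Bochner_Integration.integrable_sum[OF int])
  have "(\<integral>e. g (part (fst e)) \<partial>(\<mu> \<Otimes>\<^sub>M uniform_draw)) =
     (\<Sum>i=1..k. \<integral>e. g i * indicator (I i \<times> {0..1}) e \<partial>(\<mu> \<Otimes>\<^sub>M uniform_draw))"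
    by (subst Bochner_Integration.integral_cong[OF refl eq], assumption) (rule Bochner_Integration.integral_sum[OF int])
  also have "\<dots> = (\<Sum>i=1..k. g i * measure \<mu> (I i))"
    using class_event[OF sub] by (intro sum.cong) auto
  finally show "(\<integral>e. g (part (fst e)) \<partial>(\<mu> \<Otimes>\<^sub>M uniform_draw)) = (\<Sum>i=1..k. g i * measure \<mu> (I i))" .
qed

lemma space_items: "e \<in> space (\<mu> \<Otimes>\<^sub>M uniform_draw) \<longleftrightarrow> fst e \<in> V \<and> snd e \<in> {0..1}"
  by (auto simp: space_pair_measure space_law space_uniform_draw mem_Times_iff)

section \<open>Stability\<close>

lemma energy_drift:
  assumes "w \<in> S"
  shows "(\<integral>\<^sup>+e. ennreal (energy (next_queue w e)) \<partial>(\<mu> \<Otimes>\<^sub>M uniform_draw)) =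
    ennreal (energy w + 2 * (\<Sum>i=1..k. (3 * measure \<mu> (I i) - 1) * load w i) + 2)" (is "?lhs = ennreal ?J")
    and "0 \<le> energy w + 2 * (\<Sum>i=1..k. (3 * measure \<mu> (I i) - 1) * load w i) + 2"
proof -
  define g where "g i = energy w + 6 * load w i - 2 * real (length w) + 2" for i
  have eq: "energy (next_queue w e) = g (part (fst e))" if "e \<in> space (\<mu> \<Otimes>\<^sub>M uniform_draw)" for e
    using energy_arrival[OF assms, of "fst e" "snd e"] that by (auto simp: space_items g_def)
  have nonneg: "0 \<le> g (part (fst e))" if "e \<in> space (\<mu> \<Otimes>\<^sub>M uniform_draw)" for e
    using energy_nonneg[OF chain.step_in_states[OF assms that]] eq[OF that] by simp
  have total: "(\<Sum>i=1..k. measure \<mu> (I i)) = 1"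
    using integral_part(2)[of "\<lambda>_. 1"] items.prob_space by simp
  have len: "real (length w) = (\<Sum>i=1..k. load w i)"
    using assms unfolding queue_details_iff by (intro sum_load[symmetric]) blast
  have "(\<Sum>i=1..k. g i * measure \<mu> (I i)) =
      (energy w - 2 * real (length w) + 2) * (\<Sum>i=1..k. measure \<mu> (I i)) + 6 * (\<Sum>i=1..k. measure \<mu> (I i) * load w i)"
    by (simp add: g_def sum_distrib_left sum.distrib[symmetric] algebra_simps)
  also have "\<dots> = energy w + 2 * (\<Sum>i=1..k. (3 * measure \<mu> (I i) - 1) * load w i) + 2"
    unfolding total len by (simp add: sum_distrib_left sum_subtractf algebra_simps)
  finally have sum: "(\<Sum>i=1..k. g i * measure \<mu> (I i)) =
    energy w + 2 * (\<Sum>i=1..k. (3 * measure \<mu> (I i) - 1) * load w i) + 2" .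
  have "(\<integral>\<^sup>+e. ennreal (energy (next_queue w e)) \<partial>(\<mu> \<Otimes>\<^sub>M uniform_draw)) =
    (\<integral>\<^sup>+e. ennreal (g (part (fst e))) \<partial>(\<mu> \<Otimes>\<^sub>M uniform_draw))"
    by (intro nn_integral_cong) (simp add: eq)
  also have "\<dots> = ennreal (\<integral>e. g (part (fst e)) \<partial>(\<mu> \<Otimes>\<^sub>M uniform_draw))"
    using nonneg by (intro nn_integral_eq_integral integral_part(1)) auto
  finally show "?lhs = ennreal ?J" by (simp only: integral_part(2) sum)
  have "0 \<le> (\<integral>e. g (part (fst e)) \<partial>(\<mu> \<Otimes>\<^sub>M uniform_draw))"
    using nonneg by (intro Bochner_Integration.integral_nonneg_AE AE_I2)
  then show "0 \<le> ?J" by (simp only: integral_part(2) sum)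
qed

text \<open>
  Prescribing the class of the next item is an event of positive probability; the draw is left free, so the
  conclusion needs all choices that the policy may make.
\<close>

lemma leads_to_arrival:
  assumes w: "w \<in> S" and c: "c \<in> V"
    and after: "\<And>u. u \<in> {0..1} \<Longrightarrow> chain.leads_to x (arrival E \<Phi> w c u)"
  shows "chain.leads_to x w"
proof (rule chain.leads_to.step[OF w])
  let ?A = "{c} \<times> {0..1 :: real}"
  show "?A \<in> sets (\<mu> \<Otimes>\<^sub>M uniform_draw)" using class_event(1)[of "{c}"] c by simp
  show "0 < items.prob ?A"
    using class_event(2)[of "{c}"] c law by (simp add: positive_prob_measures_def)
  show "chain.leads_to x (next_queue w e)" if "e \<in> ?A" for e
    using after that by auto
  have "next_queue w ` ?A \<subseteq> {v. set v \<subseteq> V \<and> length v \<le> Suc (length w)}"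
  proof
    fix v assume "v \<in> next_queue w ` ?A"
    then obtain u where u: "u \<in> {0..1}" and v: "v = arrival E \<Phi> w c u" by auto
    have "length v \<le> Suc (length w)"
      unfolding v using w c u
    proof (cases rule: arrival_cases)
      case (matched p q)
      then show "length (arrival E \<Phi> w c u) \<le> Suc (length w)"
        using length_nths_remove2[of p w q] by simp
    qed simp
    moreover have "v \<in> S" unfolding v using w c u by (rule arrival_in_queue_details)
    ultimately show "v \<in> {v. set v \<subseteq> V \<and> length v \<le> Suc (length w)}" by (simp add: queue_details_iff)
  qed
  then show "finite (next_queue w ` ?A)"
    using finite_lists_length_le[OF finite_V] finite_subset by blast
qed

text \<open>
  If the items of \<open>x\<close> arrive in their order, all of them are stored, since no prefix of \<open>x\<close> contains a hyperedge.
\<close>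

lemma leads_to_prefix:
  assumes x: "x \<in> S" and "j \<le> length x"
  shows "chain.leads_to x (take j x)"
  using assms(2)
proof (induction j rule: inc_induct)
  case base
  show ?case by (simp add: chain.leads_to.here)
next
  case (step j)
  have prefix: "take m x \<in> S" for m
  proof -
    have "card (part ` set (take m x)) \<le> card (part ` set x)"
      using set_take_subset[of m x] by (intro card_mono) auto
    then show ?thesis using x set_take_subset[of m x] by (auto simp: queue_details_iff)
  qed
  have c: "x ! j \<in> V" using x step.hyps by (auto simp: queue_details_iff)
  have "take (Suc j) x = take j x @ [x ! j]" using step.hyps by (simp add: take_Suc_conv_app_nth)
  moreover have "possible_matches E (take j x) (x ! j) = {}"
    using prefix[of j] prefix[of "Suc j"] c calculation
    by (simp add: possible_matches_empty_iff queue_details_iff card.insert_remove)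
  ultimately have arr: "arrival E \<Phi> (take j x) (x ! j) u = take (Suc j) x" for u by (simp add: arrival_def)
  show ?case by (rule leads_to_arrival[OF prefix c]) (simp only: arr step.IH)
qed

lemma absent_part:
  assumes "w \<in> S"
  obtains c where "c \<in> V" "part c \<notin> part ` set w"
proof -
  have "\<not> {1..k} \<subseteq> part ` set w"
  proof
    assume "{1..k} \<subseteq> part ` set w"
    then have "card {1..k} \<le> card (part ` set w)" by (intro card_mono) auto
    then show False using assms three_parts by (simp add: queue_details_iff)
  qed
  then show ?thesis using I_nonempty that by blast
qed

text \<open>
  An item of a third part is matched, whatever the policy chooses, and so shortens the queue by two items.
\<close>

lemma leads_to_two_parts:
  assumes w: "w \<in> S" and card: "card (part ` set w) = 2"
    and shorter: "\<And>v. v \<in> S \<Longrightarrow> length v + 2 = length w \<Longrightarrow> chain.leads_to x v"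
  shows "chain.leads_to x w"
proof -
  obtain c where c: "c \<in> V" "part c \<notin> part ` set w" using absent_part[OF w] .
  show ?thesis
  proof (rule leads_to_arrival[OF w c(1)])
    fix u :: real assume u: "u \<in> {0..1}"
    have ne: "possible_matches E w c \<noteq> {}"
      using w c card by (simp add: possible_matches_empty_iff queue_details_iff)
    have "length (arrival E \<Phi> w c u) + 2 = length w"
      using w c(1) u
    proof (cases rule: arrival_cases)
      case stored
      then show ?thesis using ne by simp
    next
      case (matched p q)
      then show ?thesis using length_nths_remove2[of p w q] by simp
    qed
    then show "chain.leads_to x (arrival E \<Phi> w c u)"
      using shorter arrival_in_queue_details[OF w c(1) u] by blast
  qed
qed

text \<open>
  Every queue can be emptied: if it meets two parts, an item of a third part shortens it; if it meets one part, storing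
  an item of another part leads to the first case and a net loss of one item.
\<close>

lemma leads_to_all:
  assumes x: "x \<in> S" and "w \<in> S"
  shows "chain.leads_to x w"
  using \<open>w \<in> S\<close>
proof (induction w rule: length_induct)
  case (1 w)
  then have w: "w \<in> S" and IH: "\<And>v. v \<in> S \<Longrightarrow> length v < length w \<Longrightarrow> chain.leads_to x v" by blast+
  have wV: "set w \<subseteq> V" using w by (simp add: queue_details_iff)
  consider "w = []" | "card (part ` set w) = 1" | "card (part ` set w) = 2"
    using w by (cases "card (part ` set w)") (auto simp: queue_details_iff le_Suc_eq numeral_2_eq_2)
  then show ?case
  proof cases
    case 1
    then show ?thesis using leads_to_prefix[OF x, of 0] by simp
  next
    case 2
    obtain c where c: "c \<in> V" "part c \<notin> part ` set w" using absent_part[OF w] .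
    have "possible_matches E w c = {}"
      using c 2 wV by (simp add: possible_matches_empty_iff)
    then have arr: "arrival E \<Phi> w c u = w @ [c]" for u by (simp add: arrival_def)
    have S: "w @ [c] \<in> S" and card: "card (part ` set (w @ [c])) = 2"
      using c 2 wV by (auto simp: queue_details_iff)
    have goal: "chain.leads_to x (w @ [c])"
      by (rule leads_to_two_parts[OF S card]) (auto intro: IH)
    show ?thesis by (rule leads_to_arrival[OF w c(1)]) (simp only: arr goal)
  next
    case 3
    then show ?thesis by (rule leads_to_two_parts[OF w]) (auto intro: IH)
  qed
qed

text \<open>
  With \<open>\<delta> = 1 - 3 max m\<^sub>i\<close>, the drift of the energy is at most \<open>-2 \<delta> n + 2\<close>, which is at most \<open>-1\<close> as soon as
  \<open>n \<ge> 3 / (2 \<delta>)\<close>; the shorter queues form a finite set.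
\<close>

theorem stable_if:
  assumes "\<forall>i\<in>{1..k}. measure \<mu> (I i) < 1 / 3"
  shows "stable_model V E \<Phi> \<mu>"
  unfolding stable_model_iff
proof
  fix x assume x: "x \<in> S"
  define m where "m = Max ((\<lambda>i. measure \<mu> (I i)) ` {1..k})"
  have ne: "{1..k} \<noteq> {}" using three_parts by simp
  have m: "measure \<mu> (I i) \<le> m" if "i \<in> {1..k}" for i
    unfolding m_def using that by auto
  have "m \<in> (\<lambda>i. measure \<mu> (I i)) ` {1..k}" unfolding m_def using ne by (intro Max_in) auto
  then have m3: "m < 1 / 3" using assms by auto
  define \<delta> where "\<delta> = 1 - 3 * m"
  have \<delta>: "0 < \<delta>" using m3 by (simp add: \<delta>_def)
  define F where "F = {w \<in> S. real (length w) < 3 / (2 * \<delta>)}"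
  have "finite F"
  proof (rule finite_subset)
    show "F \<subseteq> {w. set w \<subseteq> V \<and> length w \<le> nat \<lceil>3 / (2 * \<delta>)\<rceil>}"
      by (auto simp: F_def queue_details_iff) linarith
    show "finite {w. set w \<subseteq> V \<and> length w \<le> nat \<lceil>3 / (2 * \<delta>)\<rceil>}"
      by (rule finite_lists_length_le[OF finite_V])
  qed
  have drift: "1 + (\<integral>\<^sup>+e. ennreal (energy (next_queue w e)) \<partial>(\<mu> \<Otimes>\<^sub>M uniform_draw)) \<le> ennreal (energy w)"
    if "w \<in> S - F" for w
  proof -
    have w: "w \<in> S" and long: "3 / (2 * \<delta>) \<le> real (length w)" using that by (auto simp: F_def)
    let ?J = "energy w + 2 * (\<Sum>i=1..k. (3 * measure \<mu> (I i) - 1) * load w i) + 2"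
    have "(\<Sum>i=1..k. (3 * measure \<mu> (I i) - 1) * load w i) \<le> (\<Sum>i=1..k. - \<delta> * load w i)"
      using m by (intro sum_mono mult_right_mono load_nonneg) (auto simp: \<delta>_def)
    also have "\<dots> = - \<delta> * real (length w)"
      using w unfolding queue_details_iff sum_distrib_left[symmetric] by (simp only: sum_load)
    also have "\<dots> \<le> - 3 / 2"
      using long \<delta> by (simp add: field_simps)
    finally have J: "1 + ?J \<le> energy w" by simp
    have "1 + ennreal ?J = ennreal (1 + ?J)"
      using energy_drift(2)[OF w] by (simp only: ennreal_plus ennreal_1 zero_le_one)
    also have "\<dots> \<le> ennreal (energy w)" using J by (rule ennreal_leI)
    finally show ?thesis by (simp only: energy_drift(1)[OF w])
  qed
  show "(\<integral>\<^sup>+\<omega>. return_time (chain.orbit x \<omega>) x \<partial>stream_space (\<mu> \<Otimes>\<^sub>M uniform_draw)) < \<infinity>"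
  proof (rule chain.Foster_Lyapunov[where L = "\<lambda>w. ennreal (energy w)" and F = F])
    show "finite F" "F \<subseteq> S" "x \<in> S" using \<open>finite F\<close> x by (auto simp: F_def)
    show "chain.leads_to x w" if "w \<in> F" for w using that leads_to_all[OF x] by (auto simp: F_def)
    show "(\<integral>\<^sup>+e. ennreal (energy (next_queue w e)) \<partial>(\<mu> \<Otimes>\<^sub>M uniform_draw)) < \<infinity>" if "w \<in> S" for w
      by (simp add: energy_drift(1)[OF that] del: ennreal_plus)
  qed (rule drift)
qed

section \<open>Instability\<close>

text \<open>
  If part \<open>i\<close> has probability at least \<open>1/3\<close>, its excess is a submartingale; it is \<open>0\<close> for the empty queue and \<open>2\<close> after
  the arrival of a single item of part \<open>i\<close>.
\<close>

theorem stable_only_if: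
  assumes stable: "stable_model V E \<Phi> \<mu>" and i: "i \<in> {1..k}"
  shows "measure \<mu> (I i) < 1 / 3"
proof (rule ccontr)
  assume heavy: "\<not> ?thesis"
  have excess_next: "excess i w + (3 * of_bool (part (fst e) = i) - 1) \<le> excess i (next_queue w e)"
      "excess i (next_queue w e) \<le> excess i w + 2"
    if "w \<in> S" "e \<in> space (\<mu> \<Otimes>\<^sub>M uniform_draw)" for w e
    using excess_arrival[OF that(1), of "fst e" "snd e"] that(2) by (auto simp: space_items)
  have int: "integrable (\<mu> \<Otimes>\<^sub>M uniform_draw) (\<lambda>e. excess i (next_queue w e))" if w: "w \<in> S" for w
  proof (rule items.integrable_const_bound)
    show "AE e in \<mu> \<Otimes>\<^sub>M uniform_draw. norm (excess i (next_queue w e)) \<le> \<bar>excess i w\<bar> + 2"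
    proof (rule AE_I2)
      fix e assume "e \<in> space (\<mu> \<Otimes>\<^sub>M uniform_draw)"
      from excess_next[OF w this] show "norm (excess i (next_queue w e)) \<le> \<bar>excess i w\<bar> + 2"
        by (auto simp: abs_le_iff split: if_splits) (auto simp: of_bool_def split: if_splits)
    qed
    show "(\<lambda>e. excess i (next_queue w e)) \<in> borel_measurable (\<mu> \<Otimes>\<^sub>M uniform_draw)"
      by (rule chain.borel_measurable_comp_step[OF w])
  qed
  have sub: "excess i w \<le> (\<integral>e. excess i (next_queue w e) \<partial>(\<mu> \<Otimes>\<^sub>M uniform_draw))" if w: "w \<in> S" for w
  proof -
    let ?g = "\<lambda>j. excess i w + (3 * of_bool (j = i) - 1)"
    have "(\<Sum>j=1..k. measure \<mu> (I j)) = 1"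
      using integral_part(2)[of "\<lambda>_. 1"] items.prob_space by simp
    moreover have "(\<Sum>j=1..k. ?g j * measure \<mu> (I j)) =
      (\<Sum>j=1..k. (excess i w - 1) * measure \<mu> (I j) + (if j = i then 3 * measure \<mu> (I i) else 0))"
      by (intro sum.cong) (auto simp: algebra_simps)
    ultimately have "(\<Sum>j=1..k. ?g j * measure \<mu> (I j)) = excess i w - 1 + 3 * measure \<mu> (I i)"
      using i by (simp add: sum.distrib flip: sum_distrib_left)
    then have "excess i w \<le> (\<integral>e. ?g (part (fst e)) \<partial>(\<mu> \<Otimes>\<^sub>M uniform_draw))"
      using heavy unfolding integral_part(2)[of ?g] by simp
    also have "\<dots> \<le> (\<integral>e. excess i (next_queue w e) \<partial>(\<mu> \<Otimes>\<^sub>M uniform_draw))"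
      by (rule integral_mono[OF integral_part(1)[of ?g] int[OF w] excess_next(1)[OF w]])
    finally show ?thesis .
  qed
  obtain c where c: "c \<in> V" "part c = i" using I_nonempty[OF i] by blast
  have S: "[] \<in> S" "[c] \<in> S" using c by (auto simp: queue_details_iff)
  have first: "arrival E \<Phi> [] c u = [c]" for u
    using c possible_matches_empty_iff[of "[]" c] by (simp add: arrival_def)
  have "chain.mean_hitting [] [c] = \<infinity>"
    by (rule chain.mean_hitting_eq_infinity[where D = "excess i" and B = 2])
       (use S c excess_next(2) int sub in \<open>auto simp: excess_def load_def\<close>)
  then have "(\<integral>\<^sup>+e. \<infinity> * indicator ({c} \<times> {0..1}) e \<partial>(\<mu> \<Otimes>\<^sub>M uniform_draw)) \<le>
     (\<integral>\<^sup>+e. chain.mean_hitting [] (next_queue [] e) \<partial>(\<mu> \<Otimes>\<^sub>M uniform_draw))"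
    using first by (intro nn_integral_mono) (auto simp: indicator_def)
  moreover have "(\<integral>\<^sup>+e. \<infinity> * indicator ({c} \<times> {0..1}) e \<partial>(\<mu> \<Otimes>\<^sub>M uniform_draw)) = \<infinity>"
  proof -
    have "0 < items.prob ({c} \<times> {0..1})"
      using class_event(2)[of "{c}"] c law by (simp add: positive_prob_measures_def)
    then have "\<infinity> * emeasure (\<mu> \<Otimes>\<^sub>M uniform_draw) ({c} \<times> {0..1}) = \<infinity>"
      by (simp add: items.emeasure_eq_measure ennreal_top_mult)
    then show ?thesis
      using class_event(1)[of "{c}"] c by (subst nn_integral_cmult_indicator) auto
  qed
  ultimately show False
    using bspec[OF stable[unfolded stable_model_iff] S(1)]
    by (simp add: chain.mean_return_time[OF S(1)] top_unique)
qed

end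

section \<open>The stability region\<close>

theorem corollary4p2:
  fixes V :: "'a set" and E :: "'a set set" and k :: nat and I :: "nat \<Rightarrow> 'a set"
    and \<Phi> :: "'a policy" and \<mu> :: "'a measure"
  assumes "k \<ge> 4"
    and "complete_3_uniform_partite V E k I"
    and "admissible V E \<Phi>"
    and "\<mu> \<in> positive_prob_measures V"
  shows "stable_model V E \<Phi> \<mu> \<longleftrightarrow> (\<forall>i\<in>{1..k}. measure \<mu> (I i) < 1 / 3)"
proof -
  interpret partite_matching_model V E k I \<Phi> \<mu>
    using assms by unfold_locales auto
  show ?thesis using stable_if stable_only_if by blast
qed

end
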